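(* Let $\alpha,\beta,\gamma,p,x,y\in\mathbb{C}$ with $\mathrm{Re}(p)>0$, $\mathrm{Re}(x)>0$, $\mathrm{Re}(y)>0$, $\mathrm{Re}(\alpha)>0$, and let $a<c$ be real numbers. Then $${}^{ML}B_{p}(x,y)=2\int_{0}^{\pi/2}\cos^{2x-1}\theta\,\sin^{2y-1}\theta\;E_{\alpha,\beta}^{\gamma}\left(-p\sec^{2}\theta\csc^{2}\theta\right)d\theta,$$ $${}^{ML}B_{p}(x,y)=\int_{0}^{\infty}\frac{u^{x-1}}{(1+u)^{x+y}}\,E_{\alpha,\beta}^{\gamma}\left[-p\left(2+u+\frac{1}{u}\right)\right]du,$$ $${}^{ML}B_{p}(x,y)=2^{1-x-y}\int_{-1}^{1}(1+u)^{x-1}(1-u)^{y-1}E_{\alpha,\beta}^{\gamma}\left(-\frac{4p}{1-u^2}\right)du,$$ $${}^{ML}B_{p}(x,y)=(c-a)^{1-x-y}\int_{a}^{c}(u-a)^{x-1}(c-u)^{y-1}E_{\alpha,\beta}^{\gamma}\left(-\frac{p(c-a)^2}{(u-a)(c-u)}\right)du.$$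
   Context: The three-parameter Mittag-Leffler function is $E_{\alpha,\beta}^{\gamma}(z)=\sum_{n=0}^{\infty}\frac{(\gamma)_n}{\Gamma(\alpha n+\beta)}\frac{z^n}{n!}$ for $\alpha,\beta,\gamma\in\mathbb{C}$, $\mathrm{Re}(\alpha)>0$, where $(\gamma)_n=\gamma(\gamma+1)\cdots(\gamma+n-1)$, $(\gamma)_0=1$. The ML-generalized beta function is ${}^{ML}B_{p}(x,y)=\int_{0}^{1}t^{x-1}(1-t)^{y-1}E_{\alpha,\beta}^{\gamma}\left(-\frac{p}{t(1-t)}\right)dt$ for $\mathrm{Re}(p)>0$, $\mathrm{Re}(x)>0$, $\mathrm{Re}(y)>0$, $\mathrm{Re}(\alpha)>0$ (the parameters $\alpha,\beta,\gamma$ are suppressed in the notation). *)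

theory Defs
  imports "HOL-Analysis.Analysis"
begin

text \<open>
  Since \<open>Gamma z = 0\<close> at the poles \<open>z = 0, -1, -2, \<dots>\<close> and division by zero yields zero,
  the terms with \<open>\<alpha> n + \<beta>\<close> a non-positive integer vanish, which is the usual convention
  \<open>1 / \<Gamma>(-k) = 0\<close>.
\<close>
definition mittag_leffler3 :: "complex \<Rightarrow> complex \<Rightarrow> complex \<Rightarrow> complex \<Rightarrow> complex" where
  "mittag_leffler3 \<alpha> \<beta> \<gamma> z =
     (\<Sum>n. pochhammer \<gamma> n / Gamma (\<alpha> * of_nat n + \<beta>) * (z ^ n / fact n))"

definition mittag_leffler_beta_integrand ::
  "complex \<Rightarrow> complex \<Rightarrow> complex \<Rightarrow> complex \<Rightarrow> complex \<Rightarrow> complex \<Rightarrow> real \<Rightarrow> complex" where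
  "mittag_leffler_beta_integrand \<alpha> \<beta> \<gamma> p x y t =
     of_real t powr (x - 1) * of_real (1 - t) powr (y - 1) *
     mittag_leffler3 \<alpha> \<beta> \<gamma> (- (p / of_real (t * (1 - t))))"

text \<open>
  The integral is the Henstock--Kurzweil integral. It agrees with the Lebesgue integral where that
  exists and with the improper Riemann integral where that converges, possibly only conditionally.
  For some parameters with \<open>Re p > 0\<close>, e.g. \<open>\<alpha> = 3\<close> and \<open>\<beta> = \<gamma> = p = 1\<close>, it diverges;
  the value is then \<open>0\<close>.
\<close>
definition mittag_leffler_beta ::
  "complex \<Rightarrow> complex \<Rightarrow> complex \<Rightarrow> complex \<Rightarrow> complex \<Rightarrow> complex \<Rightarrow> complex" where
  "mittag_leffler_beta \<alpha> \<beta> \<gamma> p x y = integral {0..1} (mittag_leffler_beta_integrand \<alpha> \<beta> \<gamma> p x y)"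

end

theory Submission
  imports Defs
begin

text \<open>The formulas must also hold when the integral defining
  \<open>mittag_leffler_beta\<close> diverges, in which case both sides take the default value 0.
  Transferring convergence in one direction is not enough for this, so each substitution is stated
  as an equivalence of \<open>has_integral\<close> claims for an arbitrary value \<open>I\<close>;
  on compact intervals the converse direction is the forward one applied to the inverse function.
  Endpoints shape the hypotheses: the derivative of the squared cosine vanishes at both ends of its
  range, and the integrand may be singular there. Hence continuity is asked on the closed interval,
  while differentiability and a positive derivative are asked only inside. An unbounded integrand is
  harmless because a gauge may shrink according to the size of the integrand at the tag. What
  remains for each formula is algebra away from the endpoints: a complex power of a positive real is
  the exponential of a multiple of a real logarithm, so prefactors agree once their exponents
  do.\<close>

text \<open>
  Each formula is a change of variables in a Henstock--Kurzweil integral that need not converge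
  absolutely. For a monotone substitution \<open>g\<close>, a tagged division is carried by \<open>g\<close> to a tagged
  division of the image interval, and differentiability of \<open>g\<close> at each tag makes the two Riemann
  sums agree up to an arbitrarily small multiple of the total length. No regularity of the integrand
  is used, so the Mittag-Leffler series never has to be examined. The half-line \<open>[0, \<infinity>)\<close> is
  reached by truncation, together with Hake's theorem.
\<close>

subsection \<open>Monotone substitution\<close>

lemma strict_mono_on_image_Icc:
  fixes g :: "real \<Rightarrow> real"
  assumes "continuous_on {a..b} g" "strict_mono_on {a..b} g" "a \<le> u" "u \<le> v" "v \<le> b"
  shows "g ` {u..v} = {g u..g v}"
proof (intro equalityI subsetI)
  fix y assume "y \<in> g ` {u..v}"
  then show "y \<in> {g u..g v}"
    using assms(3-5) strict_mono_on_leD[OF assms(2)] by (auto simp: image_iff)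
next
  fix y assume y: "y \<in> {g u..g v}"
  have "continuous_on {u..v} g"
    using assms by (auto intro: continuous_on_subset)
  then show "y \<in> g ` {u..v}"
    using IVT'[of g u y v] y assms(4) by (auto simp: image_iff)
qed

text \<open>Since the tag \<open>t\<close> lies between \<open>u\<close> and \<open>v\<close>, the
  linearization errors on the two sides are at most \<open>\<epsilon> * (t - u)\<close> and
  \<open>\<epsilon> * (v - t)\<close>, which add up to exactly \<open>\<epsilon> * (v - u)\<close>.
  Summed over a division, such errors stay below \<epsilon> times the total length.\<close>

lemma derivative_straddle:
  fixes g :: "real \<Rightarrow> real"
  assumes "(g has_real_derivative D) (at t)" "\<epsilon> > 0"
  obtains \<delta> where "\<delta> > 0"
    "\<And>u v. \<lbrakk>u \<le> t; t \<le> v; t - u < \<delta>; v - t < \<delta>\<rbrakk> \<Longrightarrow> \<bar>(g v - g u) - D * (v - u)\<bar> \<le> \<epsilon> * (v - u)"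
proof -
  obtain \<delta> where \<delta>: "\<delta> > 0"
    "\<And>s. \<bar>s - t\<bar> < \<delta> \<Longrightarrow> \<bar>g s - g t - D * (s - t)\<bar> \<le> \<epsilon> * \<bar>s - t\<bar>"
    using assms unfolding has_field_derivative_def has_derivative_at_alt by fastforce
  have "\<bar>(g v - g u) - D * (v - u)\<bar> \<le> \<epsilon> * (v - u)"
    if "u \<le> t" "t \<le> v" "t - u < \<delta>" "v - t < \<delta>" for u v
  proof -
    have "\<bar>g u - g t - D * (u - t)\<bar> \<le> \<epsilon> * (t - u)" "\<bar>g v - g t - D * (v - t)\<bar> \<le> \<epsilon> * (v - t)"
      using \<delta>(2)[of u] \<delta>(2)[of v] that by auto
    then show ?thesis by (simp add: algebra_simps)
  qed
  with \<delta>(1) show thesis using that by blast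
qed

lemma tagged_division_strict_mono_image:
  fixes g :: "real \<Rightarrow> real"
  assumes cont: "continuous_on {a..b} g" and mono: "strict_mono_on {a..b} g" and "a \<le> b"
    and p: "p tagged_division_of {a..b}"
  shows "(\<lambda>(x, K). (g x, g ` K)) ` p tagged_division_of {g a..g b}"
proof -
  have inj: "inj_on g {a..b}"
    using mono by (rule strict_mono_on_imp_inj_on)
  note pD = tagged_division_ofD[OF p]
  have K: "\<exists>u v. K = {u..v} \<and> a \<le> u \<and> u \<le> v \<and> v \<le> b \<and> g ` K = {g u..g v}" if xK: "(x, K) \<in> p" for x K
  proof -
    obtain u v where "K = {u..v}" using pD(4)[OF xK] by auto
    moreover have "u \<le> v" using pD(2)[OF xK] calculation by auto
    moreover have "a \<le> u" "v \<le> b" using pD(3)[OF xK] calculation by auto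
    ultimately show ?thesis
      using strict_mono_on_image_Icc[OF cont mono] by blast
  qed
  show ?thesis
  proof (rule tagged_division_ofI)
    show "finite ((\<lambda>(x, K). (g x, g ` K)) ` p)"
      using pD(1) by simp
  next
    fix x L assume "(x, L) \<in> (\<lambda>(x, K). (g x, g ` K)) ` p"
    then obtain t K where tK: "(t, K) \<in> p" "x = g t" "L = g ` K" by auto
    show "x \<in> L" using tK pD(2) by auto
    show "L \<subseteq> {g a..g b}"
      using tK pD(3)[OF tK(1)] strict_mono_on_image_Icc[OF cont mono order.refl \<open>a \<le> b\<close> order.refl] by blast
    show "\<exists>u v. L = cbox u v" using K[OF tK(1)] tK(3) by auto
  next
    fix x1 L1 x2 L2
    assume "(x1, L1) \<in> (\<lambda>(x, K). (g x, g ` K)) ` p" "(x2, L2) \<in> (\<lambda>(x, K). (g x, g ` K)) ` p"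
      and ne: "(x1, L1) \<noteq> (x2, L2)"
    then obtain t1 K1 t2 K2 where tK: "(t1, K1) \<in> p" "x1 = g t1" "L1 = g ` K1"
        "(t2, K2) \<in> p" "x2 = g t2" "L2 = g ` K2"
      by clarsimp
    obtain u1 v1 where 1: "K1 = {u1..v1}" "a \<le> u1" "u1 \<le> v1" "v1 \<le> b" "L1 = {g u1..g v1}"
      using K[OF tK(1)] tK by auto
    obtain u2 v2 where 2: "K2 = {u2..v2}" "a \<le> u2" "u2 \<le> v2" "v2 \<le> b" "L2 = {g u2..g v2}"
      using K[OF tK(4)] tK by auto
    have "(t1, K1) \<noteq> (t2, K2)" using ne tK by auto
    then have "interior K1 \<inter> interior K2 = {}" using pD(5) tK by blast
    \<comment> \<open>Disjointness of interiors is turned into an order relation between endpoints,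
      which also covers degenerate cells. A monotone \<open>g\<close> commutes with
      \<open>min\<close> and \<open>max\<close> and therefore preserves this relation.\<close>
    then have "{max u1 u2<..<min v1 v2} = {}" using 1(1) 2(1) by auto
    then have "min v1 v2 \<le> max u1 u2" by (simp add: not_less)
    moreover have le: "g r \<le> g s" if "r \<le> s" "a \<le> r" "s \<le> b" for r s
      using strict_mono_on_leD[OF mono, of r s] that by auto
    moreover have "min (g v1) (g v2) = g (min v1 v2)"
      using le[of v1 v2] le[of v2 v1] 1 2 by (auto simp: min_def)
    moreover have "max (g u1) (g u2) = g (max u1 u2)"
      using le[of u1 u2] le[of u2 u1] 1 2 by (auto simp: max_def)
    ultimately have "min (g v1) (g v2) \<le> max (g u1) (g u2)"
      using 1 2 by simp
    then show "interior L1 \<inter> interior L2 = {}" using 1(5) 2(5) by auto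
  next
    have "{L. \<exists>x. (x, L) \<in> (\<lambda>(x, K). (g x, g ` K)) ` p} = (`) g ` {K. \<exists>x. (x, K) \<in> p}"
      by force
    then have "\<Union>{L. \<exists>x. (x, L) \<in> (\<lambda>(x, K). (g x, g ` K)) ` p} = g ` \<Union>{K. \<exists>x. (x, K) \<in> p}"
      by (simp only: image_Union)
    also have "\<dots> = g ` {a..b}" using pD(6) by simp
    also have "\<dots> = {g a..g b}"
      using strict_mono_on_image_Icc[OF cont mono order.refl \<open>a \<le> b\<close> order.refl] .
    finally show "\<Union>{L. \<exists>x. (x, L) \<in> (\<lambda>(x, K). (g x, g ` K)) ` p} = {g a..g b}" .
  qed
qed

lemma has_integral_strict_mono_substitution:
  fixes f :: "real \<Rightarrow> 'a::banach" and g g' :: "real \<Rightarrow> real"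
  assumes "a < b" and cont: "continuous_on {a..b} g" and mono: "strict_mono_on {a..b} g"
    and deriv: "\<And>t. a < t \<Longrightarrow> t < b \<Longrightarrow> (g has_real_derivative g' t) (at t)"
    and f: "(f has_integral I) {g a..g b}"
  shows "((\<lambda>t. g' t *\<^sub>R f (g t)) has_integral I) {a..b}"
proof -
  \<comment> \<open>No derivative is assumed at \<open>a\<close> and \<open>b\<close>. With the
    integrand set to 0 at their images, cells tagged there contribute 0 to both Riemann sums, and
    changing two values does not affect the integral.\<close>
  define h where "h s = (if s \<in> {g a, g b} then 0 else f s)" for s
  have h: "(h has_integral I) {g a..g b}"
    by (rule has_integral_spike_finite[OF _ _ f, of "{g a, g b}"]) (auto simp: h_def)
  have "((\<lambda>t. g' t *\<^sub>R h (g t)) has_integral I) {a..b}"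
    unfolding has_integral_real
  proof (intro allI impI)
    fix e :: real assume "e > 0"
    \<comment> \<open>Over total length \<open>b - a\<close> the straddle errors add up to at most
      \<open>e / 4\<close>; together with the \<open>e / 2\<close> from the gauge for
      \<open>h\<close> this stays strictly below \<open>e\<close>.\<close>
    define \<epsilon> where "\<epsilon> = e / (4 * (b - a))"
    have "\<epsilon> > 0" using \<open>e > 0\<close> \<open>a < b\<close> by (simp add: \<epsilon>_def)
    obtain \<gamma> where \<gamma>: "gauge \<gamma>" and \<gamma>I: "\<And>\<D>. \<D> tagged_division_of {g a..g b} \<Longrightarrow> \<gamma> fine \<D> \<Longrightarrow>
        norm ((\<Sum>(x, K)\<in>\<D>. measure lborel K *\<^sub>R h x) - I) < e / 2"
      using h[unfolded has_integral_real, rule_format, of "e / 2"] \<open>e > 0\<close> by auto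
    have "\<exists>\<delta>>0. \<forall>u v. a \<le> u \<and> u \<le> t \<and> t \<le> v \<and> v \<le> b \<and> t - u < \<delta> \<and> v - t < \<delta> \<longrightarrow>
        norm ((g v - g u) *\<^sub>R h (g t) - (v - u) *\<^sub>R g' t *\<^sub>R h (g t)) \<le> \<epsilon> * (v - u)"
      if t: "t \<in> {a..b}" for t
    proof (cases "t = a \<or> t = b")
      case True
      then have "h (g t) = 0" by (auto simp: h_def)
      then show ?thesis using \<open>\<epsilon> > 0\<close> by (intro exI[of _ 1]) auto
    next
      case False
      \<comment> \<open>The derivative tolerance is divided by the size of the integrand at the tag;
        adding 1 avoids division by zero.\<close>
      let ?N = "norm (h (g t)) + 1"
      have N: "?N > 0" by (simp add: add_nonneg_pos)
      then have "\<epsilon> / ?N > 0" using \<open>\<epsilon> > 0\<close> by simp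
      moreover have "(g has_real_derivative g' t) (at t)" using deriv t False by auto
      ultimately obtain \<delta> where \<delta>: "\<delta> > 0"
        "\<And>u v. \<lbrakk>u \<le> t; t \<le> v; t - u < \<delta>; v - t < \<delta>\<rbrakk> \<Longrightarrow>
          \<bar>(g v - g u) - g' t * (v - u)\<bar> \<le> \<epsilon> / ?N * (v - u)"
        using derivative_straddle by blast
      have "norm ((g v - g u) *\<^sub>R h (g t) - (v - u) *\<^sub>R g' t *\<^sub>R h (g t)) \<le> \<epsilon> * (v - u)"
        if "u \<le> t" "t \<le> v" "t - u < \<delta>" "v - t < \<delta>" for u v
      proof -
        have "(g v - g u) *\<^sub>R h (g t) - (v - u) *\<^sub>R g' t *\<^sub>R h (g t) = ((g v - g u) - g' t * (v - u)) *\<^sub>R h (g t)"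
          by (simp add: algebra_simps)
        then have "norm ((g v - g u) *\<^sub>R h (g t) - (v - u) *\<^sub>R g' t *\<^sub>R h (g t))
            = \<bar>(g v - g u) - g' t * (v - u)\<bar> * norm (h (g t))" by simp
        also have "\<dots> \<le> (\<epsilon> / ?N * (v - u)) * ?N"
          using \<delta>(2)[OF that] by (intro mult_mono) auto
        also have "\<dots> = \<epsilon> * (v - u)" using N by simp
        finally show ?thesis .
      qed
      then show ?thesis using \<delta>(1) by blast
    qed
    then obtain \<delta> where \<delta>: "\<And>t. t \<in> {a..b} \<Longrightarrow> \<delta> t > 0"
      "\<And>t u v. \<lbrakk>t \<in> {a..b}; a \<le> u; u \<le> t; t \<le> v; v \<le> b; t - u < \<delta> t; v - t < \<delta> t\<rbrakk> \<Longrightarrow>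
        norm ((g v - g u) *\<^sub>R h (g t) - (v - u) *\<^sub>R g' t *\<^sub>R h (g t)) \<le> \<epsilon> * (v - u)"
      by metis
    have "\<exists>\<eta>>0. \<forall>s\<in>{a..b}. \<bar>s - t\<bar> < \<eta> \<longrightarrow> g s \<in> \<gamma> (g t)" if t: "t \<in> {a..b}" for t
    proof -
      obtain r where r: "r > 0" "ball (g t) r \<subseteq> \<gamma> (g t)"
        using \<gamma> by (meson gauge_def openE)
      obtain \<eta> where "\<eta> > 0" "\<And>s. s \<in> {a..b} \<Longrightarrow> dist s t < \<eta> \<Longrightarrow> dist (g s) (g t) < r"
        using cont[unfolded continuous_on_iff] t r(1) by metis
      then show ?thesis
        using r(2) by (intro exI[of _ \<eta>]) (auto simp: dist_real_def subset_iff abs_minus_commute)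
    qed
    then obtain \<eta> where \<eta>: "\<And>t. t \<in> {a..b} \<Longrightarrow> \<eta> t > 0"
      "\<And>t s. \<lbrakk>t \<in> {a..b}; s \<in> {a..b}; \<bar>s - t\<bar> < \<eta> t\<rbrakk> \<Longrightarrow> g s \<in> \<gamma> (g t)"
      by metis
    \<comment> \<open>The radius \<open>\<delta> t\<close> serves the straddle estimate, and
      \<open>\<eta> t\<close> makes the image of a cell fine for the gauge \<gamma> at
      \<open>g t\<close>. Points outside \<open>{a..b}\<close> never occur as tags.\<close>
    define \<Gamma> where "\<Gamma> t = (if t \<in> {a..b} then ball t (min (\<delta> t) (\<eta> t)) else ball t 1)" for t
    have "gauge \<Gamma>"
      using \<delta>(1) \<eta>(1) by (auto simp: \<Gamma>_def gauge_def)
    moreover have "norm ((\<Sum>(t, K)\<in>p. measure lborel K *\<^sub>R g' t *\<^sub>R h (g t)) - I) < e"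
      if p: "p tagged_division_of {a..b}" and fine: "\<Gamma> fine p" for p
    proof -
      note pD = tagged_division_ofD[OF p]
      let ?q = "(\<lambda>(x, K). (g x, g ` K)) ` p"
      have inj: "inj_on g {a..b}" using mono by (rule strict_mono_on_imp_inj_on)
      have q: "?q tagged_division_of {g a..g b}"
        using tagged_division_strict_mono_image[OF cont mono _ p] \<open>a < b\<close> by simp
      have "\<gamma> fine ?q"
        unfolding fine_def
      proof clarify
        fix t K s assume tK: "(t, K) \<in> p" and s: "s \<in> K"
        have "t \<in> {a..b}" "s \<in> {a..b}" using pD(2,3)[OF tK] s by auto
        moreover have "s \<in> \<Gamma> t" using fine tK s unfolding fine_def by blast
        ultimately show "g s \<in> \<gamma> (g t)"
          using \<eta>(2)[of t s] by (auto simp: \<Gamma>_def dist_real_def)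
      qed
      from \<gamma>I[OF q this] have 1: "norm ((\<Sum>(x, K)\<in>?q. measure lborel K *\<^sub>R h x) - I) < e / 2" .
      \<comment> \<open>A sum over the image division can be pulled back to \<open>p\<close> only if
        distinct tagged cells keep distinct images.\<close>
      have "inj_on (\<lambda>(x, K). (g x, g ` K)) p"
      proof (rule inj_onI, clarify)
        fix t K t' K' assume "(t, K) \<in> p" "(t', K') \<in> p" "g t = g t'" "g ` K = g ` K'"
        moreover from this have "t \<in> {a..b}" "t' \<in> {a..b}" "K \<subseteq> {a..b}" "K' \<subseteq> {a..b}"
          using pD(2,3) by blast+
        ultimately show "t = t' \<and> K = K'"
          using inj inj_on_image_eq_iff[OF inj, of K K'] by (auto dest: inj_onD)
      qed
      then have "(\<Sum>(x, K)\<in>?q. measure lborel K *\<^sub>R h x) = (\<Sum>(t, K)\<in>p. measure lborel (g ` K) *\<^sub>R h (g t))"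
        by (simp add: sum.reindex split_def o_def)
      then have "(\<Sum>(t, K)\<in>p. measure lborel K *\<^sub>R g' t *\<^sub>R h (g t)) - (\<Sum>(x, K)\<in>?q. measure lborel K *\<^sub>R h x)
          = - (\<Sum>(t, K)\<in>p. measure lborel (g ` K) *\<^sub>R h (g t) - measure lborel K *\<^sub>R g' t *\<^sub>R h (g t))"
        by (simp add: sum_subtractf split_def)
      also have "norm \<dots> \<le> (\<Sum>(t, K)\<in>p. \<epsilon> * measure lborel K)"
        unfolding norm_minus_cancel
      proof (rule sum_norm_le, clarify)
        fix t K assume tK: "(t, K) \<in> p"
        obtain u v where uv: "K = {u..v}" using pD(4)[OF tK] by auto
        have t: "u \<le> t" "t \<le> v" using pD(2)[OF tK] uv by auto
        have ab: "a \<le> u" "v \<le> b" using pD(3)[OF tK] uv t by auto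
        have im: "g ` K = {g u..g v}"
          using strict_mono_on_image_Icc[OF cont mono] ab t uv by simp
        have "g u \<le> g v" using strict_mono_on_leD[OF mono, of u v] ab t by auto
        have "K \<subseteq> \<Gamma> t" using fine tK by (auto simp: fine_def)
        then have "u \<in> \<Gamma> t" "v \<in> \<Gamma> t" using uv t by auto
        then have "t - u < \<delta> t" "v - t < \<delta> t" using t ab by (auto simp: \<Gamma>_def dist_real_def)
        then show "norm (measure lborel (g ` K) *\<^sub>R h (g t) - measure lborel K *\<^sub>R g' t *\<^sub>R h (g t)) \<le> \<epsilon> * measure lborel K"
          using \<delta>(2)[of t u v] t ab \<open>g u \<le> g v\<close> by (simp add: im) (simp add: uv)
      qed
      also have "\<dots> = \<epsilon> * (\<Sum>(t, K)\<in>p. measure lborel K)"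
        by (simp add: sum_distrib_left split_def)
      also have "\<dots> = \<epsilon> * (b - a)"
        using additive_content_tagged_division[of p a b] p \<open>a < b\<close> by simp
      also have "\<dots> = e / 4" using \<open>a < b\<close> by (simp add: \<epsilon>_def field_simps)
      finally have 2: "norm ((\<Sum>(t, K)\<in>p. measure lborel K *\<^sub>R g' t *\<^sub>R h (g t)) - (\<Sum>(x, K)\<in>?q. measure lborel K *\<^sub>R h x)) \<le> e / 4" .
      have "(\<Sum>(t, K)\<in>p. measure lborel K *\<^sub>R g' t *\<^sub>R h (g t)) - I =
          ((\<Sum>(t, K)\<in>p. measure lborel K *\<^sub>R g' t *\<^sub>R h (g t)) - (\<Sum>(x, K)\<in>?q. measure lborel K *\<^sub>R h x))
          + ((\<Sum>(x, K)\<in>?q. measure lborel K *\<^sub>R h x) - I)" by simp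
      also have "norm \<dots> \<le> e / 4 + e / 2"
        using 1 2 by (intro norm_triangle_mono) auto
      finally show ?thesis using \<open>e > 0\<close> by linarith
    qed
    ultimately show "\<exists>\<gamma>. gauge \<gamma> \<and> (\<forall>\<D>. \<D> tagged_division_of {a..b} \<and> \<gamma> fine \<D> \<longrightarrow>
        norm ((\<Sum>(t, K)\<in>\<D>. measure lborel K *\<^sub>R g' t *\<^sub>R h (g t)) - I) < e)"
      by (intro exI[of _ \<Gamma>]) simp
  qed
  then show ?thesis
  proof (rule has_integral_spike_finite[rotated 2, where S = "{a, b}"])
    fix t assume "t \<in> {a..b} - {a, b}"
    then have "g a < g t" "g t < g b"
      using strict_mono_onD[OF mono, of a t] strict_mono_onD[OF mono, of t b] by auto
    then show "g' t *\<^sub>R f (g t) = g' t *\<^sub>R h (g t)" by (simp add: h_def)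
  qed simp
qed

text \<open>A positive derivative inside makes \<open>g\<close> strictly increasing on the closed
  interval, so it has a continuous inverse \<open>k\<close> with derivative
  \<open>inverse (g' (k s))\<close> at interior points. Substituting \<open>k\<close> into the
  transformed integral brings back \<open>f\<close>, because the two derivative factors
  cancel.\<close>

lemma has_integral_strict_mono_substitution_iff:
  fixes f :: "real \<Rightarrow> 'a::banach" and g g' :: "real \<Rightarrow> real"
  assumes "a < b" and cont: "continuous_on {a..b} g"
    and deriv: "\<And>t. a < t \<Longrightarrow> t < b \<Longrightarrow> (g has_real_derivative g' t) (at t)"
    and pos: "\<And>t. a < t \<Longrightarrow> t < b \<Longrightarrow> g' t > 0"
  shows "((\<lambda>t. g' t *\<^sub>R f (g t)) has_integral I) {a..b} \<longleftrightarrow> (f has_integral I) {g a..g b}"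
proof
  have mono: "strict_mono_on {a..b} g"
  proof (rule strict_mono_onI)
    fix r s assume rs: "r \<in> {a..b}" "s \<in> {a..b}" "r < s"
    show "g r < g s"
    proof (rule DERIV_pos_imp_increasing_open[OF rs(3)])
      show "\<exists>y. (g has_real_derivative y) (at x) \<and> y > 0" if "r < x" "x < s" for x
        using that rs deriv[of x] pos[of x] by auto
      show "continuous_on {r..s} g" using cont rs by (auto intro: continuous_on_subset)
    qed
  qed
  show "((\<lambda>t. g' t *\<^sub>R f (g t)) has_integral I) {a..b}" if "(f has_integral I) {g a..g b}"
    using has_integral_strict_mono_substitution[OF \<open>a < b\<close> cont mono deriv that] .
  assume *: "((\<lambda>t. g' t *\<^sub>R f (g t)) has_integral I) {a..b}"
  define k where "k = the_inv_into {a..b} g"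
  have inj: "inj_on g {a..b}" using mono by (rule strict_mono_on_imp_inj_on)
  have im: "g ` {a..b} = {g a..g b}"
    using strict_mono_on_image_Icc[OF cont mono] \<open>a < b\<close> by simp
  have kg: "k (g t) = t" if "t \<in> {a..b}" for t
    using that by (simp add: k_def the_inv_into_f_f[OF inj])
  have gk: "g (k s) = s" "k s \<in> {a..b}" if "s \<in> {g a..g b}" for s
    using that im f_the_inv_into_f[OF inj, of s] the_inv_into_into[OF inj, of s "{a..b}"]
    by (auto simp: k_def)
  have ab: "g a < g b" using strict_mono_onD[OF mono] \<open>a < b\<close> by simp
  have contk: "continuous_on {g a..g b} k"
    using continuous_on_inv_into[OF cont _ inj] im by (simp add: k_def)
  have monok: "strict_mono_on {g a..g b} k"
  proof (rule strict_mono_onI)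
    fix r s assume "r \<in> {g a..g b}" "s \<in> {g a..g b}" "r < s"
    then show "k r < k s"
      using gk strict_mono_on_leD[OF mono, of "k s" "k r"] by (metis not_le)
  qed
  have interior: "a < k s \<and> k s < b" if "g a < s" "s < g b" for s
    using gk[of s] that by (metis atLeastAtMost_iff less_eq_real_def less_irrefl)
  have derivk: "(k has_real_derivative inverse (g' (k s))) (at s)" if "g a < s" "s < g b" for s
  proof (rule DERIV_inverse_function[OF _ _ that])
    show "(g has_real_derivative g' (k s)) (at (k s))" "g' (k s) \<noteq> 0"
      using deriv pos interior[OF that] by fastforce+
    show "g (k y) = y" if "g a < y" "y < g b" for y using gk that by simp
    show "isCont k s" using contk that by (auto intro: continuous_on_interior)
  qed
  have "((\<lambda>s. inverse (g' (k s)) *\<^sub>R g' (k s) *\<^sub>R f (g (k s))) has_integral I) {g a..g b}"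
    by (rule has_integral_strict_mono_substitution[OF ab contk monok derivk, of "\<lambda>t. g' t *\<^sub>R f (g t)"])
      (use * kg \<open>a < b\<close> in auto)
  then show "(f has_integral I) {g a..g b}"
  proof (rule has_integral_spike_finite[rotated 2, where S = "{g a, g b}"])
    fix s assume "s \<in> {g a..g b} - {g a, g b}"
    then have "g a < s" "s < g b" by auto
    then show "f s = inverse (g' (k s)) *\<^sub>R g' (k s) *\<^sub>R f (g (k s))"
      using gk(1)[of s] pos[of "k s"] interior[of s] by simp
  qed simp
qed

text \<open>Reflecting \<open>t\<close> to \<open>- t\<close> reduces this to the increasing case.
  Here \<open>g'\<close> is minus the derivative, so that the weight stays positive.\<close>

lemma has_integral_strict_antimono_substitution_iff:
  fixes f :: "real \<Rightarrow> 'a::banach" and g g' :: "real \<Rightarrow> real"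
  assumes "a < b" and cont: "continuous_on {a..b} g"
    and deriv: "\<And>t. a < t \<Longrightarrow> t < b \<Longrightarrow> (g has_real_derivative - g' t) (at t)"
    and pos: "\<And>t. a < t \<Longrightarrow> t < b \<Longrightarrow> g' t > 0"
  shows "((\<lambda>t. g' t *\<^sub>R f (g t)) has_integral I) {a..b} \<longleftrightarrow> (f has_integral I) {g b..g a}"
proof -
  have "((\<lambda>t. g' (- t) *\<^sub>R f (g (- t))) has_integral I) {-b..-a} \<longleftrightarrow>
      (f has_integral I) {g (- (-b))..g (- (-a))}"
  proof (rule has_integral_strict_mono_substitution_iff[where g = "\<lambda>t. g (- t)" and g' = "\<lambda>t. g' (- t)"])
    show "continuous_on {-b..-a} (\<lambda>t. g (- t))"
      by (intro continuous_on_compose2[OF cont] continuous_intros) auto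
    show "((\<lambda>t. g (- t)) has_real_derivative g' (- t)) (at t)" if "- b < t" "t < - a" for t
      using DERIV_chain2[where f = g and g = uminus and x = t and Db = "- 1" and s = UNIV, OF deriv[of "- t"]] that
        DERIV_minus[OF DERIV_ident, of t] by simp
  qed (use assms in auto)
  then show ?thesis
    using has_integral_reflect_real[of "\<lambda>t. g' t *\<^sub>R f (g t)" I b a] by simp
qed

subsection \<open>Hake's theorem and unbounded intervals\<close>

text \<open>
  Let \<open>c n\<close> increase to \<open>b\<close>. The gauge at a tag \<open>x < b\<close> is the one given by the Henstock lemma on
  \<open>[a, c n]\<close> with tolerance \<open>\<epsilon> / 2 ^ Suc n\<close>, for some \<open>n\<close> with \<open>x < c n\<close>, cut down so that the cell
  of \<open>x\<close> stays in \<open>[a, c n]\<close>. Hence only the tag \<open>b\<close> covers the endpoint, where the limit of the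
  integrals takes over.
\<close>
lemma has_integral_Hake:
  fixes f :: "real \<Rightarrow> 'a::euclidean_space"
  assumes "a < b"
    and int: "\<And>c. a \<le> c \<Longrightarrow> c < b \<Longrightarrow> f integrable_on {a..c}"
    and lim: "((\<lambda>c. integral {a..c} f) \<longlongrightarrow> L) (at_left b)"
  shows "(f has_integral L) {a..b}"
proof -
  define h where "h = f(b := 0)"
  \<comment> \<open>The indefinite integral is completed at \<open>b\<close> by the claimed value
    \<open>L\<close>, so that its increments over any division telescope to
    \<open>L\<close>.\<close>
  define F where "F y = (if y < b then integral {a..y} f else L)" for y
  have h_eq: "h x = f x" if "x < b" for x using that by (simp add: h_def)
  have inth: "h integrable_on {a..c}" if "a \<le> c" "c < b" for c
    using integrable_cong[of "{a..c}" h f] int[OF that] that by (simp add: h_def)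
  have Fdiff: "integral {u..v} h = F v - F u" if "a \<le> u" "u \<le> v" "v < b" for u v
  proof -
    have "integral {u..v} h = integral {u..v} f"
      using that by (intro integral_cong) (auto simp: h_def)
    moreover have "integral {a..u} f + integral {u..v} f = integral {a..v} f"
      using that Henstock_Kurzweil_Integration.integral_combine[of a u v f] int[of v] by simp
    ultimately show ?thesis using that by (simp add: F_def algebra_simps)
  qed
  have "(h has_integral L) {a..b}"
    unfolding has_integral_real
  proof (intro allI impI)
    fix e :: real assume "e > 0"
    define \<epsilon> where "\<epsilon> = e / 4"
    have "\<epsilon> > 0" using \<open>e > 0\<close> by (simp add: \<epsilon>_def)
    \<comment> \<open>The shift by 2 puts \<open>c 0\<close> at the midpoint, so that already the
      first truncation exceeds \<open>a\<close>.\<close>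
    define c where "c n = b - (b - a) / (real n + 2)" for n
    have c: "a < c n" "c n < b" for n
    proof -
      have "(b - a) / (real n + 2) < (b - a) / 1"
        using \<open>a < b\<close> by (intro divide_strict_left_mono) auto
      then show "a < c n" by (simp add: c_def)
      show "c n < b" using \<open>a < b\<close> by (simp add: c_def)
    qed
    have "\<exists>n. x < c n" if "x < b" for x
    proof -
      obtain n where "real n > (b - a) / (b - x)" using reals_Archimedean2 by blast
      then have "b - a < real n * (b - x)" using that by (simp add: field_simps)
      also have "\<dots> \<le> (real n + 2) * (b - x)" using that by (intro mult_right_mono) auto
      finally have "x < c n" by (simp add: c_def field_simps)
      then show ?thesis by blast
    qed
    then obtain N where N: "\<And>x. x < b \<Longrightarrow> x < c (N x)" by metis
    let ?P = "\<lambda>n \<gamma>. gauge \<gamma> \<and> (\<forall>p. p tagged_partial_division_of {a..c n} \<and> \<gamma> fine p \<longrightarrow>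
        (\<Sum>(x, K)\<in>p. norm (measure lborel K *\<^sub>R h x - integral K h)) < \<epsilon> * (1 / 2) ^ Suc n)"
    have "\<forall>n. \<exists>\<gamma>. ?P n \<gamma>"
    proof
      fix n
      have "h integrable_on cbox a (c n)" "\<epsilon> * (1 / 2) ^ Suc n > 0"
        using inth[of "c n"] c[of n] \<open>\<epsilon> > 0\<close> by simp_all
      then show "\<exists>\<gamma>. ?P n \<gamma>"
      proof (rule Henstock_lemma)
        fix \<gamma> assume "gauge \<gamma>"
          "\<And>p. p tagged_partial_division_of cbox a (c n) \<Longrightarrow> \<gamma> fine p \<Longrightarrow>
            (\<Sum>(x, K)\<in>p. norm (measure lborel K *\<^sub>R h x - integral K h)) < \<epsilon> * (1 / 2) ^ Suc n"
        then show ?thesis by (intro exI[of _ \<gamma>]) simp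
      qed
    qed
    then have "\<exists>\<gamma>. \<forall>n. ?P n (\<gamma> n)" by (rule choice)
    then obtain \<gamma> where \<gamma>: "\<And>n. gauge (\<gamma> n)"
      "\<And>n p. p tagged_partial_division_of {a..c n} \<Longrightarrow> \<gamma> n fine p \<Longrightarrow>
        (\<Sum>(x, K)\<in>p. norm (measure lborel K *\<^sub>R h x - integral K h)) < \<epsilon> * (1 / 2) ^ Suc n"
      by blast
    obtain r where r: "r < b" "\<And>y. r < y \<Longrightarrow> y < b \<Longrightarrow> dist (integral {a..y} f) L < \<epsilon>"
      using tendstoD[OF lim \<open>\<epsilon> > 0\<close>] unfolding eventually_at_left_field by blast
    \<comment> \<open>At the tag \<open>b\<close> the radius \<open>b - r\<close> confines a cell to
      the range where the truncated integrals are within \<epsilon> of \<open>L\<close>. A point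
      beyond \<open>b\<close> only needs some positive radius.\<close>
    define \<Gamma> where "\<Gamma> x = (if x < b then \<gamma> (N x) x \<inter> ball x (c (N x) - x) else ball x (if x = b then b - r else x - b))" for x
    have "gauge \<Gamma>"
      using \<gamma>(1) N r(1) by (auto simp: gauge_def \<Gamma>_def)
    moreover have "norm ((\<Sum>(x, K)\<in>p. measure lborel K *\<^sub>R h x) - L) < e"
      if p: "p tagged_division_of {a..b}" and fine: "\<Gamma> fine p" for p
    proof -
      note pD = tagged_division_ofD[OF p]
      \<comment> \<open>This is the error of one cell against the increment of \<open>F\<close>. Its
        sum over \<open>p\<close> is exactly the deviation from \<open>L\<close>, and the tags below
        \<open>b\<close> (\<open>p1\<close>) and at \<open>b\<close> (\<open>p2\<close>) contribute
        at most \<epsilon> each.\<close>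
      let ?T = "\<lambda>(x, K). measure lborel K *\<^sub>R h x - (F (Sup K) - F (Inf K))"
      define p1 where "p1 = {z \<in> p. fst z < b}"
      define p2 where "p2 = {z \<in> p. fst z = b}"
      have fin: "finite p" "finite p1" "finite p2" using pD(1) by (auto simp: p1_def p2_def)
      have "x \<le> b" if "(x, K) \<in> p" for x K
        using pD(2)[OF that] pD(3)[OF that] by auto
      then have "p = p1 \<union> p2" "p1 \<inter> p2 = {}"
        by (auto simp: p1_def p2_def less_le)
      have K\<Gamma>: "K \<subseteq> \<Gamma> x" if "(x, K) \<in> p" for x K
        using fine that by (auto simp: fine_def)
      have sub: "K \<subseteq> {a..c (N x)}" if "(x, K) \<in> p1" for x K
      proof
        fix y assume "y \<in> K"
        moreover have "(x, K) \<in> p" "x < b" using that by (auto simp: p1_def)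
        ultimately have "y \<in> {a..b}" "y \<in> \<Gamma> x" "x < b" using K\<Gamma> pD(3) by blast+
        then show "y \<in> {a..c (N x)}" by (auto simp: \<Gamma>_def dist_real_def)
      qed
      have T1: "F (Sup K) - F (Inf K) = integral K h" if xK: "(x, K) \<in> p1" for x K
      proof -
        have "(x, K) \<in> p" using xK by (simp add: p1_def)
        obtain u v where uv: "K = {u..v}" using pD(4)[OF \<open>(x, K) \<in> p\<close>] by auto
        have "u \<le> v" using pD(2)[OF \<open>(x, K) \<in> p\<close>] uv by auto
        then show ?thesis using sub[OF xK] uv Fdiff[of u v] c(2)[of "N x"] by auto
      qed
      have "norm (\<Sum>z\<in>p1. ?T z) \<le> (\<Sum>(x, K)\<in>p1. norm (measure lborel K *\<^sub>R h x - integral K h))"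
        by (rule sum_norm_le) (auto simp: T1)
      \<comment> \<open>Cells with the same \<open>N\<close> form a fine partial division of one
        interval \<open>{a..c n}\<close>, to which the Henstock estimate applies; the tolerances
        over different \<open>n\<close> are bounded by a geometric series with sum
        \<epsilon>.\<close>
      also have "\<dots> = (\<Sum>n\<in>(N \<circ> fst) ` p1. \<Sum>(x, K)\<in>{z \<in> p1. (N \<circ> fst) z = n}. norm (measure lborel K *\<^sub>R h x - integral K h))"
        by (rule sum.group[OF fin(2) finite_imageI[OF fin(2)] order.refl, symmetric])
      also have "\<dots> \<le> (\<Sum>n\<in>(N \<circ> fst) ` p1. \<epsilon> * (1 / 2) ^ Suc n)"
      proof (rule sum_mono)
        fix n
        let ?q = "{z \<in> p1. (N \<circ> fst) z = n}"
        have q: "(x, K) \<in> p1 \<and> N x = n \<and> (x, K) \<in> p \<and> x < b" if "(x, K) \<in> ?q" for x K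
          using that by (auto simp: p1_def)
        have "?q tagged_partial_division_of {a..c n}"
          unfolding tagged_partial_division_of_def
        proof (intro conjI allI impI)
          show "finite ?q" using fin(2) by simp
          show "x \<in> K" "\<exists>u v. K = cbox u v" if "(x, K) \<in> ?q" for x K
            using pD(2,4) q[OF that] by blast+
          show "K \<subseteq> {a..c n}" if "(x, K) \<in> ?q" for x K
            using sub q[OF that] by blast
          show "interior K \<inter> interior K' = {}"
            if "(x, K) \<in> ?q \<and> (x', K') \<in> ?q \<and> (x, K) \<noteq> (x', K')" for x K x' K'
            using pD(5) q that by blast
        qed
        moreover have "\<gamma> n fine ?q"
          unfolding fine_def
        proof clarify
          fix x K y assume "(x, K) \<in> p1" "n = (N \<circ> fst) (x, K)" "y \<in> K"
          then show "y \<in> \<gamma> ((N \<circ> fst) (x, K)) x"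
            using K\<Gamma>[of x K] by (auto simp: p1_def \<Gamma>_def)
        qed
        ultimately show "(\<Sum>(x, K)\<in>?q. norm (measure lborel K *\<^sub>R h x - integral K h)) \<le> \<epsilon> * (1 / 2) ^ Suc n"
          using \<gamma>(2) by (simp add: less_imp_le)
      qed
      also have "\<dots> = \<epsilon> * (\<Sum>n\<in>(N \<circ> fst) ` p1. (1 / 2) ^ Suc n)"
        by (simp add: sum_distrib_left)
      also have "\<dots> \<le> \<epsilon> * 1"
      proof (rule mult_left_mono)
        show "(\<Sum>n\<in>(N \<circ> fst) ` p1. (1 / 2 :: real) ^ Suc n) \<le> 1"
          using sum_le_suminf[of "\<lambda>n. (1 / 2 :: real) ^ Suc n" "(N \<circ> fst) ` p1"] power_half_series fin(2)
          by (simp add: sums_iff)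
      qed (use \<open>\<epsilon> > 0\<close> in simp)
      finally have 1: "norm (\<Sum>z\<in>p1. ?T z) \<le> \<epsilon>" by simp
      have K2: "\<exists>u. K = {u..b} \<and> r < u \<and> a \<le> u \<and> u \<le> b \<and> x = b" if xK: "(x, K) \<in> p2" for x K
      proof -
        have xp: "(x, K) \<in> p" "x = b" using xK by (auto simp: p2_def)
        obtain u v where uv: "K = {u..v}" using pD(4)[OF xp(1)] by auto
        have *: "b \<in> K" using pD(2)[OF xp(1)] xp(2) by simp
        then have "u \<in> K" "v \<in> K" using uv by auto
        then have "u \<in> {a..b}" "v \<in> {a..b}" "u \<in> \<Gamma> x" using pD(3)[OF xp(1)] K\<Gamma>[OF xp(1)] by blast+
        then show ?thesis using uv * xp(2) by (auto simp: \<Gamma>_def dist_real_def)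
      qed
      \<comment> \<open>A degenerate cell \<open>{b}\<close> may occur in the division but
        contributes 0. Of the other cells tagged \<open>b\<close> there is at most one, since two of
        them would overlap just below \<open>b\<close>.\<close>
      define p3 where "p3 = {z \<in> p2. snd z \<noteq> {b}}"
      have K3: "\<exists>u. K = {u..b} \<and> r < u \<and> a \<le> u \<and> u < b \<and> x = b" if xK: "(x, K) \<in> p3" for x K
      proof -
        have "(x, K) \<in> p2" "K \<noteq> {b}" using xK by (auto simp: p3_def)
        with K2 obtain u where u: "K = {u..b}" "r < u" "a \<le> u" "u \<le> b" "x = b" by blast
        moreover have "u \<noteq> b" using \<open>K \<noteq> {b}\<close> u(1) by auto
        ultimately show ?thesis by (auto simp: less_le)
      qed
      have "(\<Sum>z\<in>p2. ?T z) = (\<Sum>z\<in>p3. ?T z)"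
        using fin by (intro sum.mono_neutral_right) (auto simp: p3_def p2_def h_def)
      moreover have "norm (\<Sum>z\<in>p3. ?T z) \<le> \<epsilon>"
      proof (cases "p3 = {}")
        case False
        then obtain x K where xK: "(x, K) \<in> p3" by auto
        obtain u where u: "K = {u..b}" "r < u" "a \<le> u" "u < b" "x = b"
          using K3[OF xK] by blast
        have "z = (x, K)" if z3: "z \<in> p3" for z
        proof (rule ccontr)
          assume "z \<noteq> (x, K)"
          obtain x' K' where z: "z = (x', K')" by force
          obtain u' where u': "K' = {u'..b}" "u' < b"
            using K3[of x' K'] z3 z by blast
          have "(x, K) \<in> p" "(x', K') \<in> p" using xK z3 z by (auto simp: p3_def p2_def)
          then have "interior K \<inter> interior K' = {}"
            using pD(5) z \<open>z \<noteq> (x, K)\<close> by blast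
          moreover have "(max u u' + b) / 2 \<in> interior K \<inter> interior K'"
            using u(1,4) u' by (auto simp: max_def field_simps)
          ultimately show False by blast
        qed
        then have "p3 = {(x, K)}" using xK by blast
        then have "norm (\<Sum>z\<in>p3. ?T z) = dist (integral {a..u} f) L"
          using u by (simp add: h_def F_def dist_norm norm_minus_commute)
        then show ?thesis using r(2)[of u] u by simp
      qed (use \<open>\<epsilon> > 0\<close> in simp)
      ultimately have 2: "norm (\<Sum>z\<in>p2. ?T z) \<le> \<epsilon>" by simp
      have "(\<Sum>(x, K)\<in>p. F (Sup K) - F (Inf K)) = F b - F a"
        using additive_tagged_division_1[OF _ p] \<open>a < b\<close> by simp
      then have "(\<Sum>(x, K)\<in>p. measure lborel K *\<^sub>R h x) - L = (\<Sum>z\<in>p. ?T z)"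
        using \<open>a < b\<close> by (simp add: sum_subtractf split_def F_def)
      also have "\<dots> = (\<Sum>z\<in>p1. ?T z) + (\<Sum>z\<in>p2. ?T z)"
        using sum.union_disjoint[OF fin(2,3) \<open>p1 \<inter> p2 = {}\<close>] \<open>p = p1 \<union> p2\<close> by simp
      also have "norm \<dots> \<le> \<epsilon> + \<epsilon>"
        using 1 2 by (rule norm_triangle_mono)
      also have "\<dots> < e" using \<open>e > 0\<close> by (simp add: \<epsilon>_def)
      finally show ?thesis .
    qed
    ultimately show "\<exists>\<gamma>. gauge \<gamma> \<and> (\<forall>\<D>. \<D> tagged_division_of {a..b} \<and> \<gamma> fine \<D> \<longrightarrow>
        norm ((\<Sum>(x, K)\<in>\<D>. measure lborel K *\<^sub>R h x) - L) < e)"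
      by (intro exI[of _ \<Gamma>]) simp
  qed
  then show ?thesis
    by (rule has_integral_spike_finite[rotated 2, where S = "{b}"]) (auto simp: h_def)
qed

text \<open>The forward direction is continuity of the indefinite integral, the backward one is
  Hake's theorem. It puts the compact side of a half-line substitution into the same limit form as
  the unbounded side.\<close>

lemma has_integral_Icc_iff_tendsto:
  fixes f :: "real \<Rightarrow> 'a::euclidean_space"
  assumes "a < b"
  shows "(f has_integral L) {a..b} \<longleftrightarrow>
    (\<forall>c. a \<le> c \<and> c < b \<longrightarrow> f integrable_on {a..c}) \<and> ((\<lambda>c. integral {a..c} f) \<longlongrightarrow> L) (at_left b)"
proof (intro iffI conjI allI impI)
  assume L: "(f has_integral L) {a..b}"
  then have f: "f integrable_on {a..b}" by blast
  show "f integrable_on {a..c}" if "a \<le> c \<and> c < b" for c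
    using integrable_subinterval_real[OF f] that by simp
  have "((\<lambda>c. integral {a..c} f) \<longlongrightarrow> integral {a..b} f) (at b within {a..b})"
    using indefinite_integral_continuous_1[OF f] \<open>a < b\<close> by (simp add: continuous_on)
  then show "((\<lambda>c. integral {a..c} f) \<longlongrightarrow> L) (at_left b)"
    using L \<open>a < b\<close> by (simp add: at_within_Icc_at_left integral_unique)
qed (use assms has_integral_Hake in blast)

text \<open>The integral over an unbounded set is tested on intervals \<open>{u..v}\<close>
  containing a large ball. For a function cut off below \<open>a\<close>, only the right end
  \<open>v\<close> matters once \<open>u\<close> has passed \<open>a\<close>.\<close>

lemma has_integral_Ici_iff_tendsto:
  fixes f :: "real \<Rightarrow> 'a::banach"
  shows "(f has_integral L) {a..} \<longleftrightarrow>
    (\<forall>c. f integrable_on {a..c}) \<and> ((\<lambda>c. integral {a..c} f) \<longlongrightarrow> L) at_top"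
proof -
  let ?f = "\<lambda>x. if x \<in> {a..} then f x else 0"
  have restr: "(?f has_integral I) {u..v} \<longleftrightarrow> (f has_integral I) {max a u..v}" for u v I
  proof -
    have "(?f has_integral I) {u..v} \<longleftrightarrow> (f has_integral I) ({a..} \<inter> {u..v})"
      by (rule has_integral_restrict_Int)
    also have "{a..} \<inter> {u..v} = {max a u..v}" by auto
    finally show ?thesis .
  qed
  have restr': "?f integrable_on {u..v} \<longleftrightarrow> f integrable_on {max a u..v}"
    "integral {u..v} ?f = integral {max a u..v} f" for u v
    using restr[of _ u v] by (auto simp: integrable_on_def integral_def)
  have *: "(f has_integral L) {a..} \<longleftrightarrow> (\<forall>u v. f integrable_on {max a u..v}) \<and>
      (\<forall>e>0. \<exists>B>0. \<forall>u v. ball 0 B \<subseteq> {u..v} \<longrightarrow> norm (integral {max a u..v} f - L) < e)"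
    using has_integral_alt'[of f L "{a..}"] by (simp only: box_real restr')
  show ?thesis
  proof
    assume L: "(f has_integral L) {a..}"
    have "\<forall>\<^sub>F c in at_top. dist (integral {a..c} f) L < e" if "e > 0" for e
    proof -
      obtain B where B: "B > 0" "\<And>u v. ball 0 B \<subseteq> {u..v} \<Longrightarrow> norm (integral {max a u..v} f - L) < e"
        using L * \<open>e > 0\<close> by blast
      have "dist (integral {a..c} f) L < e" if "c \<ge> B" for c
      proof -
        have "ball 0 B \<subseteq> {min a (- B)..c}" using that by auto
        from B(2)[OF this] show ?thesis by (simp add: dist_norm)
      qed
      then show ?thesis by (auto simp: eventually_at_top_linorder)
    qed
    moreover have "f integrable_on {a..c}" for c
    proof -
      have "f integrable_on {max a a..c}" using L * by blast
      then show ?thesis by simp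
    qed
    ultimately show "(\<forall>c. f integrable_on {a..c}) \<and> ((\<lambda>c. integral {a..c} f) \<longlongrightarrow> L) at_top"
      by (auto intro: tendstoI)
  next
    assume R: "(\<forall>c. f integrable_on {a..c}) \<and> ((\<lambda>c. integral {a..c} f) \<longlongrightarrow> L) at_top"
    have "\<exists>B>0. \<forall>u v. ball 0 B \<subseteq> {u..v} \<longrightarrow> norm (integral {max a u..v} f - L) < e" if "e > 0" for e
    proof -
      obtain C where C: "\<And>c. c \<ge> C \<Longrightarrow> dist (integral {a..c} f) L < e"
        using tendstoD[OF conjunct2[OF R] \<open>e > 0\<close>] unfolding eventually_at_top_linorder by blast
      \<comment> \<open>An interval containing the ball of this radius reaches below
        \<open>a\<close> and above \<open>C\<close>.\<close>
      define B where "B = \<bar>a\<bar> + \<bar>C\<bar> + 1"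
      have "norm (integral {max a u..v} f - L) < e" if "ball 0 B \<subseteq> {u..v}" for u v
      proof -
        have "- (\<bar>a\<bar> + \<bar>C\<bar>) \<in> ball 0 B" "\<bar>a\<bar> + \<bar>C\<bar> \<in> ball 0 B" by (auto simp: B_def)
        from this[THEN subsetD[OF that]] have "u \<le> - (\<bar>a\<bar> + \<bar>C\<bar>)" "\<bar>a\<bar> + \<bar>C\<bar> \<le> v" by auto
        then have "max a u = a" "C \<le> v" by auto
        then show ?thesis using C[of v] by (simp add: dist_norm)
      qed
      moreover have "B > 0" by (simp add: B_def)
      ultimately show ?thesis by blast
    qed
    moreover have "f integrable_on {max a u..v}" for u v
      using integrable_subinterval_real[of f a v "max a u" v] R by auto
    ultimately show "(f has_integral L) {a..}" using * by blast
  qed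
qed

text \<open>Both sides become limits of integrals over truncated intervals. The compact substitution
  matches \<open>{a..r}\<close> with \<open>{g a..g r}\<close>, and every value in
  \<open>[g a, b)\<close> is some \<open>g r\<close>, so the two limits run through the same
  integrals.\<close>

lemma has_integral_Ici_substitution_iff:
  fixes f :: "real \<Rightarrow> 'a::euclidean_space" and g g' :: "real \<Rightarrow> real"
  assumes cont: "continuous_on {a..} g"
    and deriv: "\<And>t. a < t \<Longrightarrow> (g has_real_derivative g' t) (at t)"
    and pos: "\<And>t. a < t \<Longrightarrow> g' t > 0"
    and lim: "(g \<longlongrightarrow> b) at_top"
  shows "((\<lambda>t. g' t *\<^sub>R f (g t)) has_integral I) {a..} \<longleftrightarrow> (f has_integral I) {g a..b}"
proof -
  let ?h = "\<lambda>t. g' t *\<^sub>R f (g t)"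
  have less: "g r < g s" if "a \<le> r" "r < s" for r s
  proof (rule DERIV_pos_imp_increasing_open[OF that(2)])
    show "\<exists>y. (g has_real_derivative y) (at x) \<and> y > 0" if "r < x" "x < s" for x
      using that \<open>a \<le> r\<close> deriv[of x] pos[of x] by auto
    show "continuous_on {r..s} g" using cont that by (auto intro: continuous_on_subset)
  qed
  have le_b: "g r \<le> b" if "a \<le> r" for r
  proof (rule tendsto_lowerbound[OF lim])
    show "\<forall>\<^sub>F s in at_top. g r \<le> g s"
      using eventually_gt_at_top[of r] by eventually_elim (use less[OF that] in \<open>simp add: less_imp_le\<close>)
  qed simp
  have lt_b: "g r < b" if "a \<le> r" for r
    using less[of r "r + 1"] le_b[of "r + 1"] that by simp
  have surj: "\<exists>r\<ge>a. g r = y" if "g a \<le> y" "y < b" for y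
  proof -
    have "\<forall>\<^sub>F r in at_top. y < g r \<and> a \<le> r"
      using order_tendstoD(1)[OF lim \<open>y < b\<close>] eventually_ge_at_top[of a] by eventually_elim simp
    then obtain r where "y < g r" "a \<le> r"
      using eventually_happens'[OF trivial_limit_at_top_linorder] by blast
    moreover have "continuous_on {a..r} g" using cont by (auto intro: continuous_on_subset)
    ultimately show ?thesis using IVT'[of g a y r] that by auto
  qed
  have sub: "(?h has_integral J) {a..r} \<longleftrightarrow> (f has_integral J) {g a..g r}" if "a \<le> r" for r J
  proof (cases "r = a")
    case False
    then show ?thesis
      using that deriv pos cont
      by (intro has_integral_strict_mono_substitution_iff) (auto intro: continuous_on_subset)
  qed (use has_integral_null_eq[of a a ?h J] has_integral_null_eq[of "g a" "g a" f J] in simp)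
  have sub': "?h integrable_on {a..r} \<longleftrightarrow> f integrable_on {g a..g r}"
    "integral {a..r} ?h = integral {g a..g r} f" if "a \<le> r" for r
    using sub[OF that] by (auto simp: integrable_on_def integral_def)
  have "(\<forall>c. ?h integrable_on {a..c}) \<longleftrightarrow> (\<forall>c. g a \<le> c \<and> c < b \<longrightarrow> f integrable_on {g a..c})"
  proof (intro iffI allI impI)
    fix c assume "\<forall>c. ?h integrable_on {a..c}" "g a \<le> c \<and> c < b"
    then show "f integrable_on {g a..c}" using surj[of c] sub' by auto
  next
    fix c assume *: "\<forall>c. g a \<le> c \<and> c < b \<longrightarrow> f integrable_on {g a..c}"
    show "?h integrable_on {a..c}"
    proof (cases "a \<le> c")
      case True
      then have "g a \<le> g c" using less[of a c] by (cases "a = c") auto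
      then show ?thesis using * lt_b sub'(1) True by auto
    qed auto
  qed
  moreover have "((\<lambda>c. integral {a..c} ?h) \<longlongrightarrow> I) at_top \<longleftrightarrow> ((\<lambda>c. integral {g a..c} f) \<longlongrightarrow> I) (at_left b)"
  proof
    assume R: "((\<lambda>c. integral {g a..c} f) \<longlongrightarrow> I) (at_left b)"
    have "filterlim g (at_left b) at_top"
      using lim lt_b by (auto simp: filterlim_at eventually_at_top_linorder intro!: exI[of _ a])
    from filterlim_compose[OF R this] have "((\<lambda>r. integral {g a..g r} f) \<longlongrightarrow> I) at_top" .
    then show "((\<lambda>c. integral {a..c} ?h) \<longlongrightarrow> I) at_top"
      by (rule Lim_transform_eventually) (use sub' in \<open>auto simp: eventually_at_top_linorder intro!: exI[of _ a]\<close>)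
  next
    assume L: "((\<lambda>c. integral {a..c} ?h) \<longlongrightarrow> I) at_top"
    show "((\<lambda>c. integral {g a..c} f) \<longlongrightarrow> I) (at_left b)"
    proof (rule tendstoI)
      fix e :: real assume "e > 0"
      obtain C where C: "\<And>c. c \<ge> C \<Longrightarrow> dist (integral {a..c} ?h) I < e"
        using tendstoD[OF L \<open>e > 0\<close>] by (auto simp: eventually_at_top_linorder)
      let ?C = "max C a"
      have "dist (integral {g a..c} f) I < e" if c: "g ?C < c" "c < b" for c
      proof -
        have "g a \<le> g ?C" using less[of a C] by (cases "a < C") auto
        then obtain r where r: "r \<ge> a" "g r = c" using surj[of c] c by auto
        \<comment> \<open>Monotonicity replaces continuity of an inverse here: a value above
          \<open>g ?C\<close> can only come from an argument that is at least
          \<open>?C\<close>.\<close>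
        have "\<not> r < ?C" using less[OF r(1), of ?C] r(2) c(1) by (metis less_asym)
        then show ?thesis using C[of r] sub'(2)[OF r(1)] r(2) by simp
      qed
      moreover have "g ?C < b" using lt_b by simp
      ultimately show "\<forall>\<^sub>F c in at_left b. dist (integral {g a..c} f) I < e"
        unfolding eventually_at_left_field by blast
    qed
  qed
  ultimately show ?thesis
    by (simp only: has_integral_Ici_iff_tendsto has_integral_Icc_iff_tendsto[OF lt_b[OF order.refl]])
qed

subsection \<open>The integral representations\<close>

text \<open>Both \<open>integrable_on\<close> and \<open>integral\<close> are determined by the
  predicate \<open>has_integral\<close> alone. An equivalence for every \<open>I\<close> therefore
  transfers convergence and value together, including the default value under divergence.\<close>

lemma integral_scaled_transfer:
  fixes f :: "'a::euclidean_space \<Rightarrow> complex" and g :: "'b::euclidean_space \<Rightarrow> complex"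
  assumes "k \<noteq> 0" and iff: "\<And>I. ((\<lambda>s. k * g s) has_integral I) S \<longleftrightarrow> (f has_integral I) T"
  shows "(g integrable_on S \<longleftrightarrow> f integrable_on T) \<and> integral T f = k * integral S g"
proof -
  have "(\<lambda>s. k * g s) integrable_on S \<longleftrightarrow> f integrable_on T" "integral S (\<lambda>s. k * g s) = integral T f"
    unfolding integrable_on_def integral_def iff by (rule refl)+
  moreover have "(\<lambda>s. k * g s) integrable_on S \<longleftrightarrow> g integrable_on S"
    using integrable_on_mult_right[of g S k] integrable_on_mult_right[of "\<lambda>s. k * g s" S "1 / k"] \<open>k \<noteq> 0\<close>
    by auto
  ultimately show ?thesis by simp
qed

text \<open>With Jacobians and powers all written as exponentials of real logarithms, the prefactor
  identities reduce to linear identities between exponents.\<close>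

lemma of_real_powr_eq_exp:
  "r > 0 \<Longrightarrow> of_real r powr (z :: complex) = exp (z * of_real (ln r))"
  by (simp add: powr_def Ln_of_real)

lemma of_real_eq_exp_ln: "r > 0 \<Longrightarrow> complex_of_real r = exp (of_real (ln r))"
  by (simp add: exp_of_real)

text \<open>The substitution is \<open>t = (u - a) / (c - a)\<close>. The Jacobian and the two
  powers give \<open>c - a\<close> the exponent \<open>- 1 - (x - 1) - (y - 1)\<close>, which is
  \<open>1 - x - y\<close>.\<close>

lemma mittag_leffler_beta_interval:
  fixes \<alpha> \<beta> \<gamma> p x y :: complex and a c :: real
  assumes "a < c"
  defines "g \<equiv> (\<lambda>u::real. of_real (u - a) powr (x - 1) * of_real (c - u) powr (y - 1) *
    mittag_leffler3 \<alpha> \<beta> \<gamma> (- (p * of_real ((c - a) ^ 2) / of_real ((u - a) * (c - u)))))"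
  shows "(g integrable_on {a..c} \<longleftrightarrow> mittag_leffler_beta_integrand \<alpha> \<beta> \<gamma> p x y integrable_on {0..1}) \<and>
    mittag_leffler_beta \<alpha> \<beta> \<gamma> p x y = of_real (c - a) powr (1 - x - y) * integral {a..c} g"
  unfolding mittag_leffler_beta_def
proof (rule integral_scaled_transfer)
  let ?f = "mittag_leffler_beta_integrand \<alpha> \<beta> \<gamma> p x y"
  let ?\<phi> = "\<lambda>u. (u - a) / (c - a)"
  show "of_real (c - a) powr (1 - x - y) \<noteq> 0" using \<open>a < c\<close> by (simp add: powr_def)
  fix I
  have eq: "(1 / (c - a)) *\<^sub>R ?f (?\<phi> u) = of_real (c - a) powr (1 - x - y) * g u"
    if "u \<in> {a..c} - {a, c}" for u
  proof -
    define A B D where "A = u - a" and "B = c - u" and "D = c - a"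
    have pos: "A > 0" "B > 0" "D > 0" using that \<open>a < c\<close> by (auto simp: A_def B_def D_def)
    have B: "1 - A / D = B / D" using pos by (simp add: field_simps) (simp add: A_def B_def D_def)
    have z: "- (p / of_real (A / D * (B / D))) = - (p * of_real (D ^ 2) / of_real (A * B))"
      using pos by (simp add: field_simps power2_eq_square)
    have D: "complex_of_real (1 / D) = exp (- of_real (ln D))"
      using of_real_eq_exp_ln[of "1 / D"] pos by (simp add: ln_div del: of_real_divide)
    have "of_real (1 / D) * (of_real (A / D) powr (x - 1) * of_real (B / D) powr (y - 1)) =
        of_real D powr (1 - x - y) * (of_real A powr (x - 1) * of_real B powr (y - 1))"
      using pos unfolding D
      by (simp add: of_real_powr_eq_exp ln_div exp_add[symmetric] algebra_simps del: of_real_divide)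
    then show ?thesis
      unfolding mittag_leffler_beta_integrand_def g_def A_def[symmetric] B_def[symmetric] D_def[symmetric] B z scaleR_conv_of_real
      by (simp only: mult.assoc[symmetric] mult_1)
  qed
  have "((\<lambda>u. (1 / (c - a)) *\<^sub>R ?f (?\<phi> u)) has_integral I) {a..c} \<longleftrightarrow> (?f has_integral I) {?\<phi> a..?\<phi> c}"
    using \<open>a < c\<close>
    by (intro has_integral_strict_mono_substitution_iff) (auto intro!: derivative_eq_intros continuous_intros)
  also have "((\<lambda>u. (1 / (c - a)) *\<^sub>R ?f (?\<phi> u)) has_integral I) {a..c} \<longleftrightarrow>
      ((\<lambda>u. of_real (c - a) powr (1 - x - y) * g u) has_integral I) {a..c}"
    by (rule has_integral_spike_finite_eq[of "{a, c}"]) (simp_all only: eq finite.intros)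
  finally show "((\<lambda>u. of_real (c - a) powr (1 - x - y) * g u) has_integral I) {a..c} \<longleftrightarrow> (?f has_integral I) {0..1}"
    using \<open>a < c\<close> by simp
qed

text \<open>The substitution is the square of \<open>cos \<theta>\<close>, which decreases from 1 to
  0. Its Jacobian \<open>2 * cos \<theta> * sin \<theta>\<close> raises the exponents
  \<open>2 * x - 2\<close> and \<open>2 * y - 2\<close> by one and leaves the factor 2.\<close>

lemma mittag_leffler_beta_trig:
  fixes \<alpha> \<beta> \<gamma> p x y :: complex
  defines "g \<equiv> (\<lambda>\<theta>::real. of_real (cos \<theta>) powr (2 * x - 1) * of_real (sin \<theta>) powr (2 * y - 1) *
    mittag_leffler3 \<alpha> \<beta> \<gamma> (- p * of_real ((1 / cos \<theta>) ^ 2) * of_real ((1 / sin \<theta>) ^ 2)))"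
  shows "(g integrable_on {0..pi/2} \<longleftrightarrow> mittag_leffler_beta_integrand \<alpha> \<beta> \<gamma> p x y integrable_on {0..1}) \<and>
    mittag_leffler_beta \<alpha> \<beta> \<gamma> p x y = 2 * integral {0..pi/2} g"
  unfolding mittag_leffler_beta_def
proof (rule integral_scaled_transfer)
  let ?f = "mittag_leffler_beta_integrand \<alpha> \<beta> \<gamma> p x y"
  let ?\<phi> = "\<lambda>\<theta>::real. (cos \<theta>)\<^sup>2"
  show "(2::complex) \<noteq> 0" by simp
  fix I
  have pos: "cos \<theta> > 0" "sin \<theta> > 0" if "0 < \<theta>" "\<theta> < pi / 2" for \<theta> :: real
    using that by (auto intro: cos_gt_zero sin_gt_zero)
  have eq: "(2 * cos \<theta> * sin \<theta>) *\<^sub>R ?f (?\<phi> \<theta>) = 2 * g \<theta>" if "\<theta> \<in> {0..pi/2} - {0, pi/2}" for \<theta>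
  proof -
    define C S where "C = cos \<theta>" and "S = sin \<theta>"
    have pos: "C > 0" "S > 0" using that pos[of \<theta>] by (auto simp: C_def S_def)
    have S: "1 - C\<^sup>2 = S\<^sup>2" by (simp add: C_def S_def sin_squared_eq)
    have z: "- (p / of_real (C\<^sup>2 * S\<^sup>2)) = - p * of_real ((1 / C)\<^sup>2) * of_real ((1 / S)\<^sup>2)"
      using pos by (simp add: field_simps)
    have CS: "complex_of_real (2 * C * S) = 2 * exp (of_real (ln C) + of_real (ln S))"
      using pos by (simp add: exp_add of_real_eq_exp_ln[symmetric])
    have "of_real (2 * C * S) * (of_real (C\<^sup>2) powr (x - 1) * of_real (S\<^sup>2) powr (y - 1)) =
        2 * (of_real C powr (2 * x - 1) * of_real S powr (2 * y - 1))"
      using pos unfolding CS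
      by (simp add: of_real_powr_eq_exp ln_realpow exp_add[symmetric] algebra_simps del: of_real_power)
    then show ?thesis
      unfolding mittag_leffler_beta_integrand_def g_def C_def[symmetric] S_def[symmetric] S z scaleR_conv_of_real
      by (simp only: mult.assoc[symmetric] mult_1)
  qed
  have "((\<lambda>\<theta>. (2 * cos \<theta> * sin \<theta>) *\<^sub>R ?f (?\<phi> \<theta>)) has_integral I) {0..pi/2} \<longleftrightarrow>
      (?f has_integral I) {?\<phi> (pi/2)..?\<phi> 0}"
    using pos
    by (intro has_integral_strict_antimono_substitution_iff) (auto intro!: derivative_eq_intros continuous_intros)
  also have "((\<lambda>\<theta>. (2 * cos \<theta> * sin \<theta>) *\<^sub>R ?f (?\<phi> \<theta>)) has_integral I) {0..pi/2} \<longleftrightarrow>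
      ((\<lambda>\<theta>. 2 * g \<theta>) has_integral I) {0..pi/2}"
    by (rule has_integral_spike_finite_eq[of "{0, pi/2}"]) (simp_all only: eq finite.intros)
  finally show "((\<lambda>\<theta>. 2 * g \<theta>) has_integral I) {0..pi/2} \<longleftrightarrow> (?f has_integral I) {0..1}"
    by simp
qed

text \<open>With \<open>t = u / (1 + u)\<close> one has \<open>1 - t = 1 / (1 + u)\<close>, hence
  \<open>1 / (t * (1 - t)) = 2 + u + 1 / u\<close>. The exponent of \<open>1 + u\<close> is
  \<open>- 2 - (x - 1) - (y - 1)\<close>, that is \<open>- (x + y)\<close>.\<close>

lemma mittag_leffler_beta_half_line:
  fixes \<alpha> \<beta> \<gamma> p x y :: complex
  defines "g \<equiv> (\<lambda>u::real. of_real u powr (x - 1) / of_real (1 + u) powr (x + y) *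
    mittag_leffler3 \<alpha> \<beta> \<gamma> (- p * of_real (2 + u + 1 / u)))"
  shows "(g integrable_on {0..} \<longleftrightarrow> mittag_leffler_beta_integrand \<alpha> \<beta> \<gamma> p x y integrable_on {0..1}) \<and>
    mittag_leffler_beta \<alpha> \<beta> \<gamma> p x y = integral {0..} g"
proof -
  let ?f = "mittag_leffler_beta_integrand \<alpha> \<beta> \<gamma> p x y"
  \<comment> \<open>In this form of \<open>u / (1 + u)\<close> the derivative and the limit 1 at
    infinity can be read off directly.\<close>
  let ?\<phi> = "\<lambda>u::real. 1 - 1 / (1 + u)"
  have eq: "(1 / (1 + u)\<^sup>2) *\<^sub>R ?f (?\<phi> u) = 1 * g u" if "u \<in> {0..} - {0}" for u
  proof -
    define W where "W = 1 + u"
    have pos: "u > 0" "W > 0" using that by (auto simp: W_def)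
    have t: "1 - 1 / W = u / W" "1 - u / W = 1 / W" using pos by (simp_all add: field_simps W_def)
    have "1 / (u / W * (1 / W)) = 2 + u + 1 / u"
      using pos by (simp add: field_simps W_def)
    then have "of_real (2 + u + 1 / u) = 1 / complex_of_real (u / W * (1 / W))"
      by (metis of_real_1 of_real_divide)
    then have z: "- (p / of_real (u / W * (1 / W))) = - p * of_real (2 + u + 1 / u)"
      by simp
    have W: "complex_of_real (1 / W\<^sup>2) = exp (- 2 * of_real (ln W))"
      using of_real_eq_exp_ln[of "1 / W\<^sup>2"] pos by (simp add: ln_div ln_realpow del: of_real_divide of_real_power)
    have "of_real (1 / W\<^sup>2) * (of_real (u / W) powr (x - 1) * of_real (1 / W) powr (y - 1)) =
        of_real u powr (x - 1) / of_real W powr (x + y)"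
      using pos unfolding W
      by (simp add: of_real_powr_eq_exp ln_div exp_add[symmetric] exp_diff[symmetric] algebra_simps
          del: of_real_divide of_real_add)
    then show ?thesis
      unfolding mittag_leffler_beta_integrand_def g_def W_def[symmetric] t z scaleR_conv_of_real
      by (simp only: mult.assoc[symmetric] mult_1)
  qed
  have lim: "(?\<phi> \<longlongrightarrow> 1 - 0) at_top"
    by (intro tendsto_diff tendsto_const tendsto_divide_0[OF tendsto_const] filterlim_at_top_imp_at_infinity
        filterlim_tendsto_add_at_top[OF tendsto_const] filterlim_ident)
  have "((\<lambda>u. 1 * g u) has_integral I) {0..} \<longleftrightarrow> (?f has_integral I) {0..1}" for I
  proof -
    have "((\<lambda>u. (1 / (1 + u)\<^sup>2) *\<^sub>R ?f (?\<phi> u)) has_integral I) {0..} \<longleftrightarrow> (?f has_integral I) {?\<phi> 0..1}"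
      using lim
      by (intro has_integral_Ici_substitution_iff)
        (auto intro!: derivative_eq_intros continuous_intros simp: power2_eq_square)
    also have "((\<lambda>u. (1 / (1 + u)\<^sup>2) *\<^sub>R ?f (?\<phi> u)) has_integral I) {0..} \<longleftrightarrow>
        ((\<lambda>u. 1 * g u) has_integral I) {0..}"
      by (rule has_integral_spike_finite_eq[of "{0}"]) (simp_all only: eq finite.intros)
    finally show ?thesis by simp
  qed
  from integral_scaled_transfer[OF _ this] show ?thesis
    by (simp add: mittag_leffler_beta_def)
qed

text \<open>The integrability equivalences give the equalities their full meaning: the default value
  0 appears on both sides together, never on one side in place of a convergent integral.\<close>

theorem theorem2p6:
  fixes \<alpha> \<beta> \<gamma> p x y :: complex and a c :: real
  assumes "Re p > 0" and "Re x > 0" and "Re y > 0" and "Re \<alpha> > 0" and "a < c"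
  shows
   "(let g = (\<lambda>\<theta>::real. of_real (cos \<theta>) powr (2 * x - 1) * of_real (sin \<theta>) powr (2 * y - 1) *
               mittag_leffler3 \<alpha> \<beta> \<gamma>
                 (- p * of_real ((1 / cos \<theta>) ^ 2) * of_real ((1 / sin \<theta>) ^ 2)))
     in (g integrable_on {0..pi/2} \<longleftrightarrow> mittag_leffler_beta_integrand \<alpha> \<beta> \<gamma> p x y integrable_on {0..1}) \<and>
        mittag_leffler_beta \<alpha> \<beta> \<gamma> p x y = 2 * integral {0..pi/2} g)
   \<and>
    (let g = (\<lambda>u::real. of_real u powr (x - 1) / of_real (1 + u) powr (x + y) *
               mittag_leffler3 \<alpha> \<beta> \<gamma> (- p * of_real (2 + u + 1 / u)))
     in (g integrable_on {0..} \<longleftrightarrow> mittag_leffler_beta_integrand \<alpha> \<beta> \<gamma> p x y integrable_on {0..1}) \<and>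
        mittag_leffler_beta \<alpha> \<beta> \<gamma> p x y = integral {0..} g)
   \<and>
    (let g = (\<lambda>u::real. of_real (1 + u) powr (x - 1) * of_real (1 - u) powr (y - 1) *
               mittag_leffler3 \<alpha> \<beta> \<gamma> (- (4 * p / of_real (1 - u ^ 2))))
     in (g integrable_on {-1..1} \<longleftrightarrow> mittag_leffler_beta_integrand \<alpha> \<beta> \<gamma> p x y integrable_on {0..1}) \<and>
        mittag_leffler_beta \<alpha> \<beta> \<gamma> p x y = 2 powr (1 - x - y) * integral {-1..1} g)
   \<and>
    (let g = (\<lambda>u::real. of_real (u - a) powr (x - 1) * of_real (c - u) powr (y - 1) *
               mittag_leffler3 \<alpha> \<beta> \<gamma> (- (p * of_real ((c - a) ^ 2) / of_real ((u - a) * (c - u)))))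
     in (g integrable_on {a..c} \<longleftrightarrow> mittag_leffler_beta_integrand \<alpha> \<beta> \<gamma> p x y integrable_on {0..1}) \<and>
        mittag_leffler_beta \<alpha> \<beta> \<gamma> p x y = of_real (c - a) powr (1 - x - y) * integral {a..c} g)"
proof -
  \<comment> \<open>The third formula is the interval formula for \<open>{- 1..1}\<close>, where the
    squared length is 4 and the product of the two distances is \<open>1 - u ^ 2\<close>.\<close>
  have "(\<lambda>u::real. of_real (1 + u) powr (x - 1) * of_real (1 - u) powr (y - 1) *
      mittag_leffler3 \<alpha> \<beta> \<gamma> (- (4 * p / of_real (1 - u ^ 2)))) =
    (\<lambda>u. of_real (u - (- 1)) powr (x - 1) * of_real (1 - u) powr (y - 1) *
      mittag_leffler3 \<alpha> \<beta> \<gamma> (- (p * of_real ((1 - (- 1)) ^ 2) / of_real ((u - (- 1)) * (1 - u)))))"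
    by (simp add: algebra_simps power2_eq_square)
  with mittag_leffler_beta_interval[of "- 1" 1 x y \<alpha> \<beta> \<gamma> p] show ?thesis
    unfolding Let_def
    using mittag_leffler_beta_trig mittag_leffler_beta_half_line mittag_leffler_beta_interval[OF \<open>a < c\<close>]
    by simp
qed

end
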